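(* Suppose that $(\Omega,*,1)$ is an integral commutative quantale. Then the following conditions are equivalent: (1) $\Omega$ is a Girard quantale, i.e. it satisfies the law of double negation: $(\alpha\to 0)\to 0=\alpha$ for all $\alpha\in\Omega$. (2) For every completely distributive $\Omega$-lattice $A$, the dual $A^{\rm op}$ is also a completely distributive $\Omega$-lattice. (3) $\Omega^{\rm op}$, the dual of the $\Omega$-category $\Omega$ with $\Omega(\alpha,\beta)=\alpha\to\beta$, is a complete $\Omega$-Heyting algebra (many-valued Heyting algebra).
   Context: A commutative unital quantale $(\Omega,*,I)$ is a complete lattice $\Omega$ (least element $0$, greatest element $1$) with a commutative, associative binary operation $*$, monotone in each variable, with unit $I$, such that each $\alpha*(-)$ has a right adjoint $\alpha\to(-)$: $\alpha*\beta\le\gamma\iff\beta\le\alpha\to\gamma$. It is integral if $I=1$. An $\Omega$-category is a set $A$ with a map $A(-,-):A\times A\to\Omega$ such that $I\le A(a,a)$ and $A(a,b)*A(b,c)\le A(a,c)$. An $\Omega$-functor $f:A\to B$ is a function with $A(a,b)\le B(f(a),f(b))$. The dual is $A^{\rm op}(a,b)=A(b,a)$. $A$ is antisymmetric if $I\le A(a,b)$ and $I\le A(b,a)$ imply $a=b$. $\Omega$ itself is an $\Omega$-category via $\Omega(\alpha,\beta)=\alpha\to\beta$. $[A,B]$ denotes the $\Omega$-category of $\Omega$-functors $A\to B$ with $[A,B](f,g)=\bigwedge_{x\in A}B(f(x),g(x))$. A pair of $\Omega$-functors $f:A\to B$, $g:B\to A$ is an adjunction ($f$ left adjoint of $g$,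 $g$ right adjoint of $f$) if $B(f(a),b)=A(a,g(b))$ for all $a,b$. For a function $\phi:A\to\Omega$, a supremum $\sup\phi$ is an element $a\in A$ with $A(a,x)=\bigwedge_{z\in A}(\phi(z)\to A(z,x))$ for all $x$; an infimum $\inf\phi$ is an element $b$ with $A(x,b)=\bigwedge_{z\in A}(\phi(z)\to A(x,z))$ for all $x$. A complete $\Omega$-lattice is an antisymmetric $\Omega$-category $A$ in which every function $A\to\Omega$ has a supremum (equivalently, every function has an infimum; equivalently, the Yoneda embedding $\mathbf y:A\to[A^{\rm op},\Omega]$, $\mathbf y(a)(x)=A(x,a)$, has a left adjoint, namely $\sup:[A^{\rm op},\Omega]\to A$). A complete $\Omega$-lattice $A$ is completely distributive if $\sup:[A^{\rm op},\Omega]\to A$ has a left adjoint. For an $\Omega$-functor $f:A\to B$ and $\mu:A\to\Omega$, let $f(\mu)(b)=\bigvee_{x\in f^{-1}(b)}\mu(x)$. $\mu$ is finite if $\{a:\mu(a)\neq 0\}$ is finite. $f$ preserves finite infs if $f(\inf\mu)=\inf f(\mu)$ for every finite $\mu:A\to\Omega$ for which $\inf\mu$ exists. A complete $\Omega$-lattice $A$ is a complete $\Omega$-Heyting algebra (many-valued Heyting algebra) if $\sup:[A^{\rm op},\Omega]\to A$ preserves finite infs. *)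

theory Defs
  imports Main "HOL-Library.FuncSet"
begin

text \<open>
  A commutative unital quantale. The unit \<open>I\<close> is written \<open>1\<close>; the least and greatest
  elements of the lattice are \<open>bot\<close> and \<open>top\<close> (so integrality reads \<open>1 = top\<close>). Monotonicity
  of multiplication follows from the adjunction, see \<open>quantale_mult_mono\<close>.
\<close>

class comm_quantale = complete_lattice + comm_monoid_mult +
  fixes residuum :: "'a \<Rightarrow> 'a \<Rightarrow> 'a"  (infixr "\<leadsto>" 60)
  assumes residuum_adjoint: "\<alpha> * \<beta> \<le> \<gamma> \<longleftrightarrow> \<beta> \<le> \<alpha> \<leadsto> \<gamma>"

lemma quantale_mult_mono:
  fixes \<alpha> :: "'q::comm_quantale"
  assumes "\<alpha> \<le> \<alpha>'" and "\<beta> \<le> \<beta>'"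
  shows "\<alpha> * \<beta> \<le> \<alpha>' * \<beta>'"
proof -
  have right: "x * y \<le> x * y'" if "y \<le> y'" for x y y' :: 'q
    using that residuum_adjoint[of x y "x * y'"] residuum_adjoint[of x y' "x * y'"]
    by (meson order_refl order_trans)
  show ?thesis
    using right[OF assms(2), of \<alpha>] right[OF assms(1), of \<beta>']
    by (simp add: mult.commute)
qed

definition girard :: "'q::comm_quantale itself \<Rightarrow> bool" where
  "girard _ \<longleftrightarrow> (\<forall>\<alpha>::'q. (\<alpha> \<leadsto> bot) \<leadsto> bot = \<alpha>)"

text \<open>
  The set of objects is an explicit carrier; values of the hom map outside of it are irrelevant.
\<close>

record ('a, 'q) omega_cat =
  Ob :: "'a set"
  Hom :: "'a \<Rightarrow> 'a \<Rightarrow> 'q"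

definition omega_category :: "('a, 'q::comm_quantale) omega_cat \<Rightarrow> bool" where
  "omega_category A \<longleftrightarrow>
     (\<forall>a\<in>Ob A. 1 \<le> Hom A a a) \<and>
     (\<forall>a\<in>Ob A. \<forall>b\<in>Ob A. \<forall>c\<in>Ob A. Hom A a b * Hom A b c \<le> Hom A a c)"

definition omega_functor ::
    "('a, 'q::comm_quantale) omega_cat \<Rightarrow> ('b, 'q) omega_cat \<Rightarrow> ('a \<Rightarrow> 'b) \<Rightarrow> bool" where
  "omega_functor A B f \<longleftrightarrow>
     f \<in> Ob A \<rightarrow> Ob B \<and>
     (\<forall>a\<in>Ob A. \<forall>b\<in>Ob A. Hom A a b \<le> Hom B (f a) (f b))"

definition dual :: "('a, 'q) omega_cat \<Rightarrow> ('a, 'q) omega_cat" where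
  "dual A = \<lparr>Ob = Ob A, Hom = (\<lambda>a b. Hom A b a)\<rparr>"

definition antisymmetric :: "('a, 'q::comm_quantale) omega_cat \<Rightarrow> bool" where
  "antisymmetric A \<longleftrightarrow>
     (\<forall>a\<in>Ob A. \<forall>b\<in>Ob A. 1 \<le> Hom A a b \<longrightarrow> 1 \<le> Hom A b a \<longrightarrow> a = b)"

definition Omega :: "('q::comm_quantale, 'q) omega_cat" where
  "Omega = \<lparr>Ob = UNIV, Hom = (\<leadsto>)\<rparr>"

text \<open>
  Objects of the functor category are taken extensional, so that two functors that agree on the
  objects of \<open>A\<close> are equal.
\<close>

definition functor_cat ::
    "('a, 'q::comm_quantale) omega_cat \<Rightarrow> ('b, 'q) omega_cat \<Rightarrow> ('a \<Rightarrow> 'b, 'q) omega_cat" where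
  "functor_cat A B =
     \<lparr>Ob = {f \<in> extensional (Ob A). omega_functor A B f},
      Hom = (\<lambda>f g. INF x\<in>Ob A. Hom B (f x) (g x))\<rparr>"

text \<open>\<open>adjunction A B f g\<close>: \<open>f : A \<rightarrow> B\<close> is left adjoint to \<open>g : B \<rightarrow> A\<close>.\<close>

definition adjunction ::
    "('a, 'q::comm_quantale) omega_cat \<Rightarrow> ('b, 'q) omega_cat \<Rightarrow> ('a \<Rightarrow> 'b) \<Rightarrow> ('b \<Rightarrow> 'a) \<Rightarrow> bool"
  where
  "adjunction A B f g \<longleftrightarrow>
     omega_functor A B f \<and> omega_functor B A g \<and>
     (\<forall>a\<in>Ob A. \<forall>b\<in>Ob B. Hom B (f a) b = Hom A a (g b))"

definition is_sup :: "('a, 'q::comm_quantale) omega_cat \<Rightarrow> ('a \<Rightarrow> 'q) \<Rightarrow> 'a \<Rightarrow> bool" where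
  "is_sup A \<phi> a \<longleftrightarrow>
     a \<in> Ob A \<and> (\<forall>x\<in>Ob A. Hom A a x = (INF z\<in>Ob A. \<phi> z \<leadsto> Hom A z x))"

definition is_inf :: "('a, 'q::comm_quantale) omega_cat \<Rightarrow> ('a \<Rightarrow> 'q) \<Rightarrow> 'a \<Rightarrow> bool" where
  "is_inf A \<phi> b \<longleftrightarrow>
     b \<in> Ob A \<and> (\<forall>x\<in>Ob A. Hom A x b = (INF z\<in>Ob A. \<phi> z \<leadsto> Hom A x z))"

definition complete_omega_lattice :: "('a, 'q::comm_quantale) omega_cat \<Rightarrow> bool" where
  "complete_omega_lattice A \<longleftrightarrow>
     omega_category A \<and> antisymmetric A \<and> (\<forall>\<phi>. \<exists>a. is_sup A \<phi> a)"

text \<open>Well defined in a complete lattice: suprema exist, and are unique by antisymmetry.\<close>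

definition omega_sup :: "('a, 'q::comm_quantale) omega_cat \<Rightarrow> ('a \<Rightarrow> 'q) \<Rightarrow> 'a" where
  "omega_sup A \<phi> = (THE a. is_sup A \<phi> a)"

abbreviation presheaves ::
    "('a, 'q::comm_quantale) omega_cat \<Rightarrow> ('a \<Rightarrow> 'q, 'q) omega_cat" where
  "presheaves A \<equiv> functor_cat (dual A) Omega"

definition completely_distributive :: "('a, 'q::comm_quantale) omega_cat \<Rightarrow> bool" where
  "completely_distributive A \<longleftrightarrow>
     complete_omega_lattice A \<and> (\<exists>l. adjunction A (presheaves A) l (omega_sup A))"

definition push_forward ::
    "('a, 'q::comm_quantale) omega_cat \<Rightarrow> ('a \<Rightarrow> 'b) \<Rightarrow> ('a \<Rightarrow> 'q) \<Rightarrow> 'b \<Rightarrow> 'q" where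
  "push_forward A f \<mu> b = (SUP x\<in>{x \<in> Ob A. f x = b}. \<mu> x)"

definition finite_map :: "('a, 'q::comm_quantale) omega_cat \<Rightarrow> ('a \<Rightarrow> 'q) \<Rightarrow> bool" where
  "finite_map A \<mu> \<longleftrightarrow> finite {a \<in> Ob A. \<mu> a \<noteq> bot}"

text \<open>
  \<open>f (inf \<mu>) = inf (f \<mu>)\<close> is stated relationally: the image of an infimum of \<open>\<mu>\<close> is an infimum
  of \<open>f \<mu>\<close>. In particular \<open>inf (f \<mu>)\<close> is required to exist.
\<close>

definition preserves_finite_infs ::
    "('a, 'q::comm_quantale) omega_cat \<Rightarrow> ('b, 'q) omega_cat \<Rightarrow> ('a \<Rightarrow> 'b) \<Rightarrow> bool" where
  "preserves_finite_infs A B f \<longleftrightarrow>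
     (\<forall>\<mu> a. finite_map A \<mu> \<longrightarrow> is_inf A \<mu> a \<longrightarrow> is_inf B (push_forward A f \<mu>) (f a))"

definition complete_heyting :: "('a, 'q::comm_quantale) omega_cat \<Rightarrow> bool" where
  "complete_heyting A \<longleftrightarrow>
     complete_omega_lattice A \<and> preserves_finite_infs (presheaves A) A (omega_sup A)"

text \<open>
  Since HOL cannot quantify over types inside a formula, the type of which the carriers are
  subsets is a parameter.
\<close>

definition cd_self_dual :: "'a itself \<Rightarrow> 'q::comm_quantale itself \<Rightarrow> bool" where
  "cd_self_dual _ _ \<longleftrightarrow>
     (\<forall>A :: ('a, 'q) omega_cat. completely_distributive A \<longrightarrow> completely_distributive (dual A))"

end

theory Submission
  imports Defs
begin

text \<open>
  Write \<open>\<not>\<alpha>\<close> for \<open>\<alpha> \<leadsto> bot\<close>. The equivalences follow from four facts.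

  First, \<open>\<Omega>\<close> itself is always completely distributive: the supremum of a presheaf on \<open>\<Omega>\<close> is its
  value at the unit, and evaluation at an object has a left adjoint by the Yoneda lemma
  (\<open>completely_distributive_Omega\<close>).

  Second, a right adjoint preserves every infimum, so every completely distributive lattice is a
  complete Heyting algebra (\<open>completely_distributive_imp_complete_heyting\<close>).

  Third, if \<open>\<Omega>\<^sup>o\<^sup>p\<close> is a complete Heyting algebra then \<open>\<Omega>\<close> is Girard
  (\<open>complete_heyting_dual_Omega_imp_girard\<close>). A presheaf on \<open>\<Omega>\<^sup>o\<^sup>p\<close> is a functor
  \<open>\<phi> : \<Omega> \<rightarrow> \<Omega>\<close> with supremum \<open>\<Sqinter>z. \<phi> z \<leadsto> z\<close>, so a constant presheaf \<open>\<beta>\<close> has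
  supremum \<open>\<not>\<beta>\<close>. The cotensor of a presheaf \<open>\<phi>\<close> with \<open>\<alpha>\<close> is the infimum of a weight
  concentrated on \<open>\<phi>\<close>, hence a finite infimum; it is \<open>\<alpha> \<leadsto> \<phi>\<close>, while cotensoring in
  \<open>\<Omega>\<^sup>o\<^sup>p\<close> is multiplication with \<open>\<alpha>\<close>. Preserving the cotensor of the constant \<open>bot\<close> reads
  \<open>\<not>(\<alpha> \<leadsto> bot) = \<alpha> * \<not>bot = \<alpha>\<close>, the last step by integrality, since \<open>\<not>bot = top\<close>.

  Fourth, over a Girard quantale the dual of a completely distributive lattice is completely
  distributive (\<open>girard_imp_completely_distributive_dual\<close>). This is Raney's argument that complete
  distributivity is self-dual, with the complement of a set replaced by the negation of a weight.

  Now the law of double negation gives self-duality by the fourth fact; self-duality makes \<open>\<Omega>\<^sup>o\<^sup>p\<close>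
  completely distributive by the first, hence a Heyting algebra by the second; and that gives
  the law of double negation by the third.
\<close>

section \<open>Residuation in a commutative quantale\<close>

abbreviation neg :: "'q::comm_quantale \<Rightarrow> 'q" where
  "neg \<alpha> \<equiv> \<alpha> \<leadsto> bot"

lemma eq_if_same_lower_bounds:
  fixes x y :: "'a::order"
  assumes "\<And>z. z \<le> x \<longleftrightarrow> z \<le> y"
  shows "x = y"
  using assms by (meson order.antisym order_refl)

lemma le_residuum_commute:
  fixes \<alpha> :: "'q::comm_quantale"
  shows "\<beta> \<le> \<alpha> \<leadsto> \<gamma> \<longleftrightarrow> \<alpha> \<le> \<beta> \<leadsto> \<gamma>"
  by (metis residuum_adjoint mult.commute)

lemma residuum_mult:
  fixes \<alpha> :: "'q::comm_quantale"
  shows "(\<alpha> * \<beta>) \<leadsto> \<gamma> = \<alpha> \<leadsto> (\<beta> \<leadsto> \<gamma>)"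
  by (rule eq_if_same_lower_bounds)
    (metis residuum_adjoint mult.assoc mult.commute)

lemma residuum_left_commute:
  fixes \<alpha> :: "'q::comm_quantale"
  shows "\<alpha> \<leadsto> (\<beta> \<leadsto> \<gamma>) = \<beta> \<leadsto> (\<alpha> \<leadsto> \<gamma>)"
  by (metis residuum_mult mult.commute)

lemma one_residuum [simp]: "1 \<leadsto> \<alpha> = (\<alpha> :: 'q::comm_quantale)"
  by (rule eq_if_same_lower_bounds) (metis residuum_adjoint mult_1)

lemma one_le_residuum_iff: "1 \<le> \<alpha> \<leadsto> \<beta> \<longleftrightarrow> \<alpha> \<le> (\<beta> :: 'q::comm_quantale)"
  by (metis le_residuum_commute one_residuum)

lemma bot_residuum [simp]: "bot \<leadsto> \<alpha> = (top :: 'q::comm_quantale)"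
  by (metis top_le bot_least le_residuum_commute)

lemma mult_residuum_le:
  fixes \<alpha> :: "'q::comm_quantale"
  shows "\<alpha> * (\<alpha> \<leadsto> \<beta>) \<le> \<beta>"
  by (simp add: residuum_adjoint)

lemma residuum_mono:
  fixes \<alpha> :: "'q::comm_quantale"
  assumes "\<alpha>' \<le> \<alpha>" and "\<beta> \<le> \<beta>'"
  shows "\<alpha> \<leadsto> \<beta> \<le> \<alpha>' \<leadsto> \<beta>'"
  by (meson assms order_trans residuum_adjoint mult_residuum_le quantale_mult_mono order_refl)

lemma residuum_trans:
  fixes \<alpha> :: "'q::comm_quantale"
  shows "(\<alpha> \<leadsto> \<beta>) * (\<beta> \<leadsto> \<gamma>) \<le> \<alpha> \<leadsto> \<gamma>"
proof -
  have "\<alpha> * ((\<alpha> \<leadsto> \<beta>) * (\<beta> \<leadsto> \<gamma>)) \<le> \<beta> * (\<beta> \<leadsto> \<gamma>)"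
    by (metis mult.assoc mult_residuum_le order_refl quantale_mult_mono)
  then show ?thesis
    by (meson mult_residuum_le order_trans residuum_adjoint)
qed

lemma SUP_residuum:
  fixes f :: "'i \<Rightarrow> 'q::comm_quantale"
  shows "(SUP i\<in>I. f i) \<leadsto> \<gamma> = (INF i\<in>I. f i \<leadsto> \<gamma>)"
proof (rule eq_if_same_lower_bounds)
  fix \<beta>
  have "\<beta> \<le> (SUP i\<in>I. f i) \<leadsto> \<gamma> \<longleftrightarrow> (\<forall>i\<in>I. f i \<le> \<beta> \<leadsto> \<gamma>)"
    by (subst le_residuum_commute) (rule SUP_le_iff)
  also have "\<dots> \<longleftrightarrow> (\<forall>i\<in>I. \<beta> \<le> f i \<leadsto> \<gamma>)"
    by (intro ball_cong refl le_residuum_commute)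
  finally show "\<beta> \<le> (SUP i\<in>I. f i) \<leadsto> \<gamma> \<longleftrightarrow> \<beta> \<le> (INF i\<in>I. f i \<leadsto> \<gamma>)"
    by (simp add: le_INF_iff)
qed

lemma residuum_INF:
  fixes f :: "'i \<Rightarrow> 'q::comm_quantale"
  shows "\<alpha> \<leadsto> (INF i\<in>I. f i) = (INF i\<in>I. \<alpha> \<leadsto> f i)"
  by (rule eq_if_same_lower_bounds)
    (simp add: residuum_adjoint[symmetric] le_INF_iff)

lemma girard_neg_neg: "girard TYPE('q::comm_quantale) \<Longrightarrow> neg (neg \<alpha>) = (\<alpha> :: 'q)"
  by (simp add: girard_def)

lemma girard_contraposition:
  assumes "girard TYPE('q::comm_quantale)"
  shows "neg \<alpha> \<leadsto> \<beta> = neg \<beta> \<leadsto> (\<alpha> :: 'q)"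
  by (metis girard_neg_neg[OF assms] residuum_left_commute)

section \<open>Suprema, infima and adjunctions\<close>

lemma Ob_dual [simp]: "Ob (dual A) = Ob A"
  and Hom_dual [simp]: "Hom (dual A) a b = Hom A b a"
  and dual_dual [simp]: "dual (dual A) = A"
  by (simp_all add: dual_def)

lemma Ob_Omega [simp]: "Ob Omega = UNIV"
  and Hom_Omega [simp]: "Hom Omega \<alpha> \<beta> = \<alpha> \<leadsto> \<beta>"
  by (simp_all add: Omega_def)

lemma is_sup_dual [simp]: "is_sup (dual A) = is_inf A"
  by (intro ext) (simp add: is_sup_def is_inf_def)

lemma omega_category_refl: "omega_category A \<Longrightarrow> a \<in> Ob A \<Longrightarrow> 1 \<le> Hom A a a"
  by (simp add: omega_category_def)

lemma omega_category_trans: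
  "omega_category A \<Longrightarrow> a \<in> Ob A \<Longrightarrow> b \<in> Ob A \<Longrightarrow> c \<in> Ob A \<Longrightarrow>
    Hom A a b * Hom A b c \<le> Hom A a c"
  by (simp add: omega_category_def)

lemma omega_category_dual: "omega_category A \<Longrightarrow> omega_category (dual A)"
  by (simp add: omega_category_def) (metis mult.commute)

lemma antisymmetric_dual: "antisymmetric A \<Longrightarrow> antisymmetric (dual A)"
  by (simp add: antisymmetric_def)

lemma Hom_le_if_unit_le:
  assumes "omega_category A" "a \<in> Ob A" "b \<in> Ob A" "c \<in> Ob A"
  shows Hom_le_post: "1 \<le> Hom A b c \<Longrightarrow> Hom A a b \<le> Hom A a c"
    and Hom_le_pre: "1 \<le> Hom A a b \<Longrightarrow> Hom A b c \<le> Hom A a c"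
proof -
  note trans = omega_category_trans[OF assms]
  show "1 \<le> Hom A b c \<Longrightarrow> Hom A a b \<le> Hom A a c"
    using quantale_mult_mono[of "Hom A a b" "Hom A a b" 1 "Hom A b c"] trans
    by (auto intro: order_trans)
  show "1 \<le> Hom A a b \<Longrightarrow> Hom A b c \<le> Hom A a c"
    using quantale_mult_mono[of 1 "Hom A a b" "Hom A b c" "Hom A b c"] trans
    by (auto intro: order_trans)
qed

lemma Hom_eq_imp_eq:
  assumes "omega_category A" "antisymmetric A" "a \<in> Ob A" "b \<in> Ob A"
    and "\<And>x. x \<in> Ob A \<Longrightarrow> Hom A a x = Hom A b x"
  shows "a = b"
  using assms by (metis antisymmetric_def omega_category_refl)

lemma is_sup_unique:
  assumes "omega_category A" "antisymmetric A" "is_sup A \<phi> a" "is_sup A \<phi> b"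
  shows "a = b"
  using assms by (intro Hom_eq_imp_eq[of A]) (auto simp: is_sup_def)

lemma omega_sup_eqI:
  assumes "complete_omega_lattice A" "is_sup A \<phi> a"
  shows "omega_sup A \<phi> = a"
  unfolding omega_sup_def
  using assms by (auto simp: complete_omega_lattice_def intro: is_sup_unique)

lemma is_sup_omega_sup:
  assumes "complete_omega_lattice A"
  shows "is_sup A \<phi> (omega_sup A \<phi>)"
  using assms by (metis complete_omega_lattice_def omega_sup_eqI)

lemma is_sup_upper:
  assumes "omega_category A" "is_sup A \<phi> s" "z \<in> Ob A"
  shows "\<phi> z \<le> Hom A z s"
proof -
  have "s \<in> Ob A" "Hom A s s = (INF z\<in>Ob A. \<phi> z \<leadsto> Hom A z s)"
    using assms by (auto simp: is_sup_def)
  then have "1 \<le> \<phi> z \<leadsto> Hom A z s"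
    using omega_category_refl[OF assms(1), of s] assms(3) by (simp add: le_INF_iff)
  then show ?thesis
    by (simp add: one_le_residuum_iff)
qed

lemma is_inf_lower:
  assumes "omega_category A" "is_inf A \<phi> s" "z \<in> Ob A"
  shows "\<phi> z \<le> Hom A s z"
  using is_sup_upper[of "dual A" \<phi> s z] assms by (simp add: omega_category_dual)

text \<open>As for ordinary lattices, an infimum is the supremum of the lower bounds, here weighted by
  the degree to which an object is a lower bound.\<close>

lemma complete_omega_lattice_dual:
  assumes A: "complete_omega_lattice A"
  shows "complete_omega_lattice (dual A)"
proof -
  have cat: "omega_category A" and anti: "antisymmetric A"
    using A by (auto simp: complete_omega_lattice_def)
  have "\<exists>b. is_inf A \<phi> b" for \<phi>
  proof -
    define \<psi> where "\<psi> = (\<lambda>x. INF z\<in>Ob A. \<phi> z \<leadsto> Hom A x z)"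
    obtain b where b: "is_sup A \<psi> b"
      using A by (auto simp: complete_omega_lattice_def)
    then have bA: "b \<in> Ob A"
      by (simp add: is_sup_def)
    have lower: "\<phi> z \<le> Hom A b z" if "z \<in> Ob A" for z
    proof -
      have "\<phi> z \<le> \<psi> x \<leadsto> Hom A x z" for x
        using that by (subst le_residuum_commute) (auto simp: \<psi>_def intro: INF_lower)
      then show ?thesis
        using b that by (simp add: is_sup_def le_INF_iff)
    qed
    have "Hom A x b = \<psi> x" if x: "x \<in> Ob A" for x
    proof (rule order.antisym)
      show "\<psi> x \<le> Hom A x b"
        by (rule is_sup_upper[OF cat b x])
      have "Hom A x b \<le> \<phi> z \<leadsto> Hom A x z" if z: "z \<in> Ob A" for z
      proof -
        have "Hom A x b * \<phi> z \<le> Hom A x b * Hom A b z"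
          by (rule quantale_mult_mono[OF order_refl lower[OF z]])
        also have "\<dots> \<le> Hom A x z"
          by (rule omega_category_trans[OF cat x bA z])
        finally show ?thesis
          by (simp add: residuum_adjoint[symmetric] mult.commute)
      qed
      then show "Hom A x b \<le> \<psi> x"
        by (simp add: \<psi>_def le_INF_iff)
    qed
    then have "is_inf A \<phi> b"
      using bA by (simp add: is_inf_def \<psi>_def)
    then show ?thesis ..
  qed
  then show ?thesis
    by (simp add: complete_omega_lattice_def omega_category_dual[OF cat] antisymmetric_dual[OF anti])
qed

text \<open>The hom equation alone forces both maps to be functors: the unit
  \<open>a' \<rightarrow> g (f a')\<close> and the counit come from it, and composing with them yields functoriality.\<close>

lemma adjunctionI:
  assumes A: "omega_category A" and B: "omega_category B"
    and f: "f \<in> Ob A \<rightarrow> Ob B" and g: "g \<in> Ob B \<rightarrow> Ob A"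
    and hom: "\<And>a b. a \<in> Ob A \<Longrightarrow> b \<in> Ob B \<Longrightarrow> Hom B (f a) b = Hom A a (g b)"
  shows "adjunction A B f g"
proof -
  have "Hom A a a' \<le> Hom B (f a) (f a')" if a: "a \<in> Ob A" "a' \<in> Ob A" for a a'
  proof -
    have "f a' \<in> Ob B"
      using f a by auto
    then have "1 \<le> Hom A a' (g (f a'))"
      using omega_category_refl[OF B] hom a by metis
    then have "Hom A a a' \<le> Hom A a (g (f a'))"
      using f g a by (intro Hom_le_post[OF A]) auto
    then show ?thesis
      using hom a \<open>f a' \<in> Ob B\<close> by simp
  qed
  moreover have "Hom B b b' \<le> Hom A (g b) (g b')" if b: "b \<in> Ob B" "b' \<in> Ob B" for b b'
  proof -
    have "g b \<in> Ob A"
      using g b by auto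
    then have "1 \<le> Hom B (f (g b)) b"
      using omega_category_refl[OF A] hom b by metis
    then have "Hom B b b' \<le> Hom B (f (g b)) b'"
      using f g b by (intro Hom_le_pre[OF B]) auto
    then show ?thesis
      using hom b \<open>g b \<in> Ob A\<close> by simp
  qed
  ultimately show ?thesis
    using f g hom by (auto simp: adjunction_def omega_functor_def)
qed

lemma right_adjoint_preserves_inf:
  assumes adj: "adjunction A B f g" and inf: "is_inf B \<mu> b"
  shows "is_inf A (push_forward B g \<mu>) (g b)"
proof -
  have f: "f \<in> Ob A \<rightarrow> Ob B" and g: "g \<in> Ob B \<rightarrow> Ob A"
    and hom: "\<And>a b. a \<in> Ob A \<Longrightarrow> b \<in> Ob B \<Longrightarrow> Hom B (f a) b = Hom A a (g b)"
    using adj by (auto simp: adjunction_def omega_functor_def)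
  have b: "b \<in> Ob B"
    using inf by (simp add: is_inf_def)
  have "Hom A x (g b) = (INF z\<in>Ob A. push_forward B g \<mu> z \<leadsto> Hom A x z)"
    if x: "x \<in> Ob A" for x
  proof -
    have "Hom A x (g b) = Hom B (f x) b"
      using hom x b by simp
    also have "\<dots> = (INF w\<in>Ob B. \<mu> w \<leadsto> Hom B (f x) w)"
      using inf f x by (auto simp: is_inf_def)
    also have "\<dots> = (INF w\<in>Ob B. \<mu> w \<leadsto> Hom A x (g w))"
      using hom x by (intro INF_cong) auto
    also have "\<dots> = (INF z\<in>Ob A. push_forward B g \<mu> z \<leadsto> Hom A x z)"
    proof (rule eq_if_same_lower_bounds)
      fix c
      show "c \<le> (INF w\<in>Ob B. \<mu> w \<leadsto> Hom A x (g w)) \<longleftrightarrow>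
          c \<le> (INF z\<in>Ob A. push_forward B g \<mu> z \<leadsto> Hom A x z)"
        unfolding push_forward_def SUP_residuum le_INF_iff using g by blast
    qed
    finally show ?thesis .
  qed
  then show ?thesis
    using g b by (auto simp: is_inf_def)
qed

section \<open>Presheaves\<close>

lemma Ob_functor_cat_Omega_iff:
  "\<phi> \<in> Ob (functor_cat C Omega) \<longleftrightarrow>
    \<phi> \<in> extensional (Ob C) \<and> (\<forall>a\<in>Ob C. \<forall>b\<in>Ob C. Hom C a b \<le> \<phi> a \<leadsto> \<phi> b)"
  by (simp add: functor_cat_def omega_functor_def)

lemma restrict_presheafI:
  assumes "\<And>a b. a \<in> Ob A \<Longrightarrow> b \<in> Ob A \<Longrightarrow> Hom A b a \<le> f a \<leadsto> f b"
  shows "restrict f (Ob A) \<in> Ob (presheaves A)"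
  using assms by (simp add: Ob_functor_cat_Omega_iff)

lemma Hom_functor_cat_Omega: "Hom (functor_cat C Omega) \<phi> \<psi> = (INF x\<in>Ob C. \<phi> x \<leadsto> \<psi> x)"
  by (simp add: functor_cat_def)

lemma omega_category_functor_cat_Omega: "omega_category (functor_cat C Omega)"
proof -
  have "Hom (functor_cat C Omega) \<phi> \<psi> * Hom (functor_cat C Omega) \<psi> \<chi> \<le> Hom (functor_cat C Omega) \<phi> \<chi>"
    for \<phi> \<psi> \<chi>
    unfolding Hom_functor_cat_Omega
  proof (rule INF_greatest)
    fix x assume x: "x \<in> Ob C"
    have "(INF x\<in>Ob C. \<phi> x \<leadsto> \<psi> x) * (INF x\<in>Ob C. \<psi> x \<leadsto> \<chi> x) \<le> (\<phi> x \<leadsto> \<psi> x) * (\<psi> x \<leadsto> \<chi> x)"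
      using x by (intro quantale_mult_mono INF_lower)
    also have "\<dots> \<le> \<phi> x \<leadsto> \<chi> x"
      by (rule residuum_trans)
    finally show "(INF x\<in>Ob C. \<phi> x \<leadsto> \<psi> x) * (INF x\<in>Ob C. \<psi> x \<leadsto> \<chi> x) \<le> \<phi> x \<leadsto> \<chi> x" .
  qed
  moreover have "1 \<le> Hom (functor_cat C Omega) \<phi> \<phi>" for \<phi>
    by (simp add: Hom_functor_cat_Omega le_INF_iff one_le_residuum_iff)
  ultimately show ?thesis
    by (simp add: omega_category_def)
qed

lemma is_sup_representable:
  assumes A: "omega_category A" and a: "a \<in> Ob A"
  shows "is_sup A (\<lambda>x\<in>Ob A. Hom A x a) a"
proof -
  have "Hom A a x = (INF z\<in>Ob A. Hom A z a \<leadsto> Hom A z x)" if x: "x \<in> Ob A" for x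
  proof (rule order.antisym)
    show "Hom A a x \<le> (INF z\<in>Ob A. Hom A z a \<leadsto> Hom A z x)"
      using omega_category_trans[OF A _ a x]
      by (simp add: le_INF_iff residuum_adjoint[symmetric])
    have "(INF z\<in>Ob A. Hom A z a \<leadsto> Hom A z x) \<le> Hom A a a \<leadsto> Hom A a x"
      using a by (rule INF_lower)
    also have "\<dots> \<le> 1 \<leadsto> Hom A a x"
      by (intro residuum_mono omega_category_refl[OF A a] order_refl)
    finally show "(INF z\<in>Ob A. Hom A z a \<leadsto> Hom A z x) \<le> Hom A a x"
      by simp
  qed
  then show ?thesis
    using a by (simp add: is_sup_def)
qed

section \<open>Complete distributivity and Heyting algebras\<close>

lemma completely_distributiveI:
  assumes A: "complete_omega_lattice A"
    and l: "l \<in> Ob A \<rightarrow> Ob (presheaves A)"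
    and hom: "\<And>a \<phi>. a \<in> Ob A \<Longrightarrow> \<phi> \<in> Ob (presheaves A) \<Longrightarrow>
      (INF x\<in>Ob A. l a x \<leadsto> \<phi> x) = Hom A a (omega_sup A \<phi>)"
  shows "completely_distributive A"
proof -
  have "omega_category A"
    using A by (simp add: complete_omega_lattice_def)
  moreover have "omega_sup A \<in> Ob (presheaves A) \<rightarrow> Ob A"
    using is_sup_omega_sup[OF A] by (auto simp: is_sup_def)
  ultimately have "adjunction A (presheaves A) l (omega_sup A)"
    using l hom by (intro adjunctionI omega_category_functor_cat_Omega) (auto simp: Hom_functor_cat_Omega)
  then show ?thesis
    using A by (auto simp: completely_distributive_def)
qed

lemma completely_distributive_imp_complete_heyting:
  assumes "completely_distributive A"
  shows "complete_heyting A"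
  using assms right_adjoint_preserves_inf
  by (fastforce simp: completely_distributive_def complete_heyting_def preserves_finite_infs_def)

lemma is_sup_Omega: "is_sup Omega \<phi> (SUP z. \<phi> z * z)"
  by (simp add: is_sup_def SUP_residuum residuum_mult)

lemma complete_Omega: "complete_omega_lattice (Omega :: ('q::comm_quantale, 'q) omega_cat)"
  using is_sup_Omega
  by (auto simp: complete_omega_lattice_def omega_category_def antisymmetric_def
      one_le_residuum_iff residuum_trans)

text \<open>Each term \<open>\<phi> z * z\<close> of the supremum is bounded by \<open>\<phi> 1\<close>, since \<open>z = Hom Omega 1 z\<close> acts
  on the presheaf.\<close>

lemma omega_sup_Omega_presheaf:
  fixes \<phi> :: "'q::comm_quantale \<Rightarrow> 'q"
  assumes \<phi>: "\<phi> \<in> Ob (presheaves Omega)"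
  shows "omega_sup Omega \<phi> = \<phi> 1"
proof -
  have "\<phi> z * z \<le> \<phi> 1" for z
  proof -
    have "1 \<leadsto> z \<le> \<phi> z \<leadsto> \<phi> 1"
      using \<phi> by (simp add: Ob_functor_cat_Omega_iff del: one_residuum)
    then show ?thesis
      by (simp add: residuum_adjoint)
  qed
  then have "(SUP z. \<phi> z * z) = \<phi> 1"
    by (intro order.antisym SUP_least) (auto intro: SUP_upper2[of 1])
  then show ?thesis
    using omega_sup_eqI[OF complete_Omega is_sup_Omega] by metis
qed

text \<open>The left adjoint sends \<open>\<alpha>\<close> to \<open>\<alpha> * Hom Omega - 1\<close>, the tensor of \<open>\<alpha>\<close> with the presheaf represented by
  the unit; the adjunction is the Yoneda lemma.\<close>

lemma completely_distributive_Omega: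
  "completely_distributive (Omega :: ('q::comm_quantale, 'q) omega_cat)"
proof (rule completely_distributiveI[OF complete_Omega])
  show "(\<lambda>\<alpha> z. \<alpha> * (z \<leadsto> 1)) \<in> Ob Omega \<rightarrow> Ob (presheaves (Omega :: ('q, 'q) omega_cat))"
  proof
    fix \<alpha> :: 'q
    have "b \<leadsto> a \<le> \<alpha> * (a \<leadsto> 1) \<leadsto> \<alpha> * (b \<leadsto> 1)" for a b
    proof -
      have "(a \<leadsto> 1) * (b \<leadsto> a) \<le> b \<leadsto> 1"
        by (metis residuum_trans mult.commute)
      then have "\<alpha> * ((a \<leadsto> 1) * (b \<leadsto> a)) \<le> \<alpha> * (b \<leadsto> 1)"
        by (rule quantale_mult_mono[OF order_refl])
      then show ?thesis
        by (simp add: residuum_adjoint[symmetric] mult.assoc)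
    qed
    then show "(\<lambda>z. \<alpha> * (z \<leadsto> 1)) \<in> Ob (presheaves Omega)"
      by (simp add: Ob_functor_cat_Omega_iff)
  qed
next
  fix \<alpha> :: 'q and \<phi> :: "'q \<Rightarrow> 'q"
  assume \<phi>: "\<phi> \<in> Ob (presheaves Omega)"
  have "(INF z. (z \<leadsto> 1) \<leadsto> \<phi> z) = \<phi> 1"
  proof (rule order.antisym)
    have "(INF z. (z \<leadsto> 1) \<leadsto> \<phi> z) \<le> (1 \<leadsto> 1) \<leadsto> \<phi> 1"
      by (rule INF_lower) simp
    then show "(INF z. (z \<leadsto> 1) \<leadsto> \<phi> z) \<le> \<phi> 1"
      by simp
    show "\<phi> 1 \<le> (INF z. (z \<leadsto> 1) \<leadsto> \<phi> z)"
      using \<phi> by (simp add: Ob_functor_cat_Omega_iff le_INF_iff le_residuum_commute[of "\<phi> 1"])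
  qed
  then show "(INF z\<in>Ob Omega. \<alpha> * (z \<leadsto> 1) \<leadsto> \<phi> z) = Hom Omega \<alpha> (omega_sup Omega \<phi>)"
    by (simp add: omega_sup_Omega_presheaf[OF \<phi>] residuum_mult residuum_INF[symmetric])
qed

section \<open>The Heyting property of the dual forces double negation\<close>

lemma is_inf_Omega: "is_inf Omega \<phi> (INF z. \<phi> z \<leadsto> z)"
  by (simp add: is_inf_def residuum_INF residuum_left_commute)

lemma omega_sup_dual_Omega_const:
  "omega_sup (dual Omega) (\<lambda>z. \<beta>) = neg (\<beta> :: 'q::comm_quantale)"
proof (rule omega_sup_eqI[OF complete_omega_lattice_dual[OF complete_Omega]])
  have "(INF z::'q. z) = bot"
    by (metis INF_lower UNIV_I bot.extremum_unique)
  then have "(INF z. \<beta> \<leadsto> z) = neg \<beta>"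
    by (simp only: residuum_INF[symmetric])
  then show "is_sup (dual Omega) (\<lambda>z. \<beta>) (neg \<beta>)"
    using is_inf_Omega[of "\<lambda>z. \<beta>"] by simp
qed

text \<open>The homs of \<open>\<Omega>\<close> reach \<open>top\<close>, so a constant is functorial only if \<open>\<beta> \<leadsto> \<beta> = top\<close>,
  which integrality guarantees.\<close>

lemma const_presheaf:
  assumes "(1 :: 'q::comm_quantale) = top"
  shows "(\<lambda>z. \<beta> :: 'q) \<in> Ob (presheaves (dual Omega))"
proof -
  have "top \<le> \<beta> \<leadsto> \<beta>"
    by (metis assms one_le_residuum_iff order_refl)
  then show ?thesis
    by (auto simp: Ob_functor_cat_Omega_iff top_unique)
qed

text \<open>The zero presheaf has supremum \<open>\<not>bot\<close>, the unit. So the weight for its cotensor with \<open>\<alpha>\<close> is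
  pushed forward to one concentrated at the unit, with infimum \<open>\<alpha>\<close>, while the cotensor itself
  is the constant \<open>\<not>\<alpha>\<close>, with supremum \<open>\<not>\<not>\<alpha>\<close>.\<close>

lemma complete_heyting_dual_Omega_imp_girard:
  assumes integral: "(1 :: 'q::comm_quantale) = top"
    and heyting: "complete_heyting (dual (Omega :: ('q, 'q) omega_cat))"
  shows "girard TYPE('q)"
  unfolding girard_def
proof
  fix \<alpha> :: 'q
  let ?P = "presheaves (dual (Omega :: ('q, 'q) omega_cat))"
  let ?sup = "omega_sup (dual (Omega :: ('q, 'q) omega_cat))"
  let ?zero = "\<lambda>z::'q. bot :: 'q"
  \<comment> \<open>The infimum of this weight is the cotensor of the zero presheaf with \<open>\<alpha>\<close>.\<close>
  define \<mu> where "\<mu> = (\<lambda>\<phi>::'q \<Rightarrow> 'q. if \<phi> = ?zero then \<alpha> else bot)"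
  have zero: "?zero \<in> Ob ?P"
    by (rule const_presheaf[OF integral])
  have "finite_map ?P \<mu>"
    unfolding finite_map_def by (rule finite_subset[of _ "{?zero}"]) (auto simp: \<mu>_def)
  moreover have "is_inf ?P \<mu> (\<lambda>z. neg \<alpha>)"
    unfolding is_inf_def
  proof (intro conjI ballI const_presheaf[OF integral])
    fix \<psi> assume "\<psi> \<in> Ob ?P"
    have "(INF \<phi>\<in>Ob ?P. \<mu> \<phi> \<leadsto> Hom ?P \<psi> \<phi>) = \<alpha> \<leadsto> Hom ?P \<psi> ?zero"
      using zero by (intro order.antisym INF_greatest) (auto simp: \<mu>_def intro: INF_lower2[of ?zero])
    also have "\<dots> = Hom ?P \<psi> (\<lambda>z. neg \<alpha>)"
      by (simp add: Hom_functor_cat_Omega residuum_INF residuum_left_commute)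
    finally show "Hom ?P \<psi> (\<lambda>z. neg \<alpha>) = (INF \<phi>\<in>Ob ?P. \<mu> \<phi> \<leadsto> Hom ?P \<psi> \<phi>)" ..
  qed
  ultimately have inf: "is_inf (dual Omega) (push_forward ?P ?sup \<mu>) (neg (neg \<alpha>))"
    using heyting omega_sup_dual_Omega_const[of "neg \<alpha>"]
    by (metis complete_heyting_def preserves_finite_infs_def)
  have push: "push_forward ?P ?sup \<mu> = (\<lambda>z. if z = 1 then \<alpha> else bot)"
  proof
    fix z
    have sup_zero: "?sup ?zero = 1"
      by (simp add: omega_sup_dual_Omega_const integral)
    show "push_forward ?P ?sup \<mu> z = (if z = 1 then \<alpha> else bot)"
      unfolding push_forward_def using zero sup_zero
      by (intro order.antisym SUP_least)
        (auto simp: \<mu>_def intro: SUP_upper2[of ?zero])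
  qed
  have "neg (neg \<alpha>) \<leadsto> x = \<alpha> \<leadsto> x" for x
  proof -
    have "neg (neg \<alpha>) \<leadsto> x = (INF z. (if z = 1 then \<alpha> else bot) \<leadsto> (z \<leadsto> x))"
      using inf unfolding push by (simp add: is_inf_def)
    also have "\<dots> = \<alpha> \<leadsto> x"
      by (intro order.antisym INF_greatest) (auto intro: INF_lower2[of 1])
    finally show ?thesis .
  qed
  then show "neg (neg \<alpha>) = \<alpha>"
    by (metis one_le_residuum_iff order.antisym order_refl)
qed

section \<open>Duality over a Girard quantale\<close>

text \<open>
  Let \<open>T y b\<close> be the degree to which \<open>y\<close> is totally below \<open>b\<close>, given by the left adjoint of the
  supremum. Put \<open>m x = inf (\<lambda>z. \<not> A(z, x))\<close> and \<open>n y = sup (\<lambda>z. \<not> A(y, z))\<close>, classically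
  the meet of all \<open>z\<close> not below \<open>x\<close> and the join of all \<open>z\<close> not above \<open>y\<close>. The left adjoint on the
  dual side is \<open>a \<mapsto> \<not> A(m -, a)\<close>: an object \<open>x\<close> lies totally above \<open>a\<close> when \<open>m x\<close> is not below \<open>a\<close>.

  The required equation is then \<open>A(inf \<phi>, a) = (\<Sqinter>x. \<not>\<phi> x \<leadsto> A(m x, a))\<close>. One inequality holds
  because \<open>\<not>\<phi> x \<le> A(m x, inf \<phi>)\<close>. For the other, test against \<open>y\<close> totally below \<open>inf \<phi>\<close>. By
  distributivity, \<open>T y b \<le> \<not> A(b, n y)\<close>: were \<open>b\<close> below the join \<open>n y\<close>, then \<open>y\<close> would be below
  some \<open>z\<close> not above \<open>y\<close>. With \<open>b = inf \<phi>\<close> this gives \<open>T y b \<le> \<not>\<phi> (n y)\<close>, so the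
  right-hand side bounds \<open>m (n y)\<close> by \<open>a\<close>; and \<open>y\<close> is below \<open>m (n y)\<close> by construction.
\<close>

lemma girard_imp_completely_distributive_dual:
  fixes A :: "('a, 'q::comm_quantale) omega_cat"
  assumes girard: "girard TYPE('q)" and cd: "completely_distributive A"
  shows "completely_distributive (dual A)"
proof -
  have lat: "complete_omega_lattice A"
    using cd by (simp add: completely_distributive_def)
  then have cat: "omega_category A"
    by (simp add: complete_omega_lattice_def)
  note dual_lat = complete_omega_lattice_dual[OF lat]
  let ?inf = "omega_sup (dual A)"
  have inf: "is_inf A \<phi> (?inf \<phi>)" for \<phi>
    using is_sup_omega_sup[OF dual_lat] by simp
  obtain l where l: "adjunction A (presheaves A) l (omega_sup A)"
    using cd by (auto simp: completely_distributive_def)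
  define T where "T = (\<lambda>y b. l b y)"
  have T: "(INF y\<in>Ob A. T y b \<leadsto> \<phi> y) = Hom A b (omega_sup A \<phi>)"
    if "b \<in> Ob A" "\<phi> \<in> Ob (presheaves A)" for b \<phi>
    using l that by (simp add: adjunction_def Hom_functor_cat_Omega T_def)

  have T_below: "(INF y\<in>Ob A. T y b \<leadsto> Hom A y a) = Hom A b a"
    if a: "a \<in> Ob A" and b: "b \<in> Ob A" for a b
  proof -
    have "(\<lambda>x\<in>Ob A. Hom A x a) \<in> Ob (presheaves A)"
      using omega_category_trans[OF cat] a
      by (intro restrict_presheafI) (metis residuum_adjoint mult.commute)
    from T[OF b this] show ?thesis
      by (simp add: omega_sup_eqI[OF lat is_sup_representable[OF cat a]])
  qed

  define m where "m = (\<lambda>x. ?inf (\<lambda>z. neg (Hom A z x)))"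
  define n where "n = (\<lambda>y. omega_sup A (\<lambda>z\<in>Ob A. neg (Hom A y z)))"
  have m_Ob: "m x \<in> Ob A" for x
    using inf by (simp add: m_def is_inf_def)
  have n_Ob: "n x \<in> Ob A" for x
    using is_sup_omega_sup[OF lat] by (simp add: n_def is_sup_def)
  have m_lower: "neg (Hom A z x) \<le> Hom A (m x) z" if "z \<in> Ob A" for x z
    using is_inf_lower[OF cat inf that] by (simp add: m_def)
  have n_upper: "neg (Hom A y z) \<le> Hom A z (n y)" if "z \<in> Ob A" for y z
    using is_sup_upper[OF cat is_sup_omega_sup[OF lat] that, of "\<lambda>z\<in>Ob A. neg (Hom A y z)"] that
    by (simp add: n_def)

  have m_n: "1 \<le> Hom A y (m (n y))" if y: "y \<in> Ob A" for y
  proof -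
    have "neg (Hom A z (n y)) \<le> Hom A y z" if "z \<in> Ob A" for z
      using residuum_mono[OF n_upper[OF that] order_refl[of bot]] girard_neg_neg[OF girard] by metis
    then have "1 \<le> (INF z\<in>Ob A. neg (Hom A z (n y)) \<leadsto> Hom A y z)"
      by (simp add: le_INF_iff one_le_residuum_iff)
    then show ?thesis
      using inf[of "\<lambda>z. neg (Hom A z (n y))"] y by (simp add: m_def is_inf_def)
  qed

  have T_le: "T y b \<le> neg (Hom A b (n y))" if y: "y \<in> Ob A" and b: "b \<in> Ob A" for y b
  proof -
    have "(\<lambda>z\<in>Ob A. neg (Hom A y z)) \<in> Ob (presheaves A)"
    proof (rule restrict_presheafI)
      fix u v assume "u \<in> Ob A" "v \<in> Ob A"
      then have "Hom A v u \<le> Hom A y v \<leadsto> Hom A y u"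
        using omega_category_trans[OF cat y, of v u] by (simp add: residuum_adjoint)
      then show "Hom A v u \<le> neg (Hom A y u) \<leadsto> neg (Hom A y v)"
        by (simp add: girard_contraposition[OF girard, of "Hom A y u"] girard_neg_neg[OF girard])
    qed
    from T[OF b this] have "Hom A b (n y) = (INF z\<in>Ob A. T z b \<leadsto> neg (Hom A y z))"
      by (simp add: n_def)
    also have "\<dots> \<le> T y b \<leadsto> neg (Hom A y y)"
      using y by (rule INF_lower)
    also have "\<dots> \<le> T y b \<leadsto> neg 1"
      by (intro residuum_mono omega_category_refl[OF cat y] order_refl)
    finally show ?thesis
      by (simp add: le_residuum_commute)
  qed

  define S where "S = (\<lambda>a. \<lambda>x\<in>Ob A. neg (Hom A (m x) a))"
  have "S \<in> Ob (dual A) \<rightarrow> Ob (presheaves (dual A))"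
  proof
    fix a assume "a \<in> Ob (dual A)"
    then have a: "a \<in> Ob A"
      by simp
    have "Hom A u v \<le> neg (Hom A (m u) a) \<leadsto> neg (Hom A (m v) a)"
      if u: "u \<in> Ob A" and v: "v \<in> Ob A" for u v
    proof -
      have m_functor: "Hom A u v \<le> Hom A (m u) (m v)"
      proof -
        have "Hom A u v \<le> neg (Hom A z v) \<leadsto> Hom A (m u) z" if z: "z \<in> Ob A" for z
        proof -
          have "Hom A u v \<le> Hom A z u \<leadsto> Hom A z v"
            using omega_category_trans[OF cat z u v] by (simp add: residuum_adjoint)
          also have "\<dots> = neg (Hom A z v) \<leadsto> neg (Hom A z u)"
            by (simp add: girard_contraposition[OF girard, of "Hom A z v"] girard_neg_neg[OF girard])
          also have "\<dots> \<le> neg (Hom A z v) \<leadsto> Hom A (m u) z"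
            by (rule residuum_mono[OF order_refl m_lower[OF z]])
          finally show ?thesis .
        qed
        then show ?thesis
          using inf[of "\<lambda>z. neg (Hom A z v)"] m_Ob by (simp add: m_def is_inf_def le_INF_iff)
      qed
      also have "\<dots> \<le> Hom A (m v) a \<leadsto> Hom A (m u) a"
        using omega_category_trans[OF cat m_Ob m_Ob a, of u v]
        by (simp add: residuum_adjoint[symmetric] mult.commute)
      also have "\<dots> = neg (Hom A (m u) a) \<leadsto> neg (Hom A (m v) a)"
        by (simp add: girard_contraposition[OF girard, of "Hom A (m u) a"] girard_neg_neg[OF girard])
      finally show ?thesis .
    qed
    then show "S a \<in> Ob (presheaves (dual A))"
      using restrict_presheafI[of "dual A" "\<lambda>x. neg (Hom A (m x) a)"] by (simp add: S_def)
  qed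
  moreover have "(INF x\<in>Ob (dual A). S a x \<leadsto> \<phi> x) = Hom (dual A) a (?inf \<phi>)"
    if "a \<in> Ob (dual A)" and \<phi>: "\<phi> \<in> Ob (presheaves (dual A))" for a \<phi>
  proof -
    have a: "a \<in> Ob A"
      using that by simp
    define b where "b = ?inf \<phi>"
    have b: "b \<in> Ob A" "is_inf A \<phi> b"
      using inf by (auto simp: b_def is_inf_def)
    define R where "R = (INF x\<in>Ob A. neg (\<phi> x) \<leadsto> Hom A (m x) a)"
    have "(INF x\<in>Ob A. S a x \<leadsto> \<phi> x) = R"
      unfolding R_def by (intro INF_cong) (simp_all add: S_def girard_contraposition[OF girard])
    also have "R = Hom A b a"
    proof (rule order.antisym)
      have "R \<le> T y b \<leadsto> Hom A y a" if y: "y \<in> Ob A" for y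
      proof -
        have "R \<le> neg (\<phi> (n y)) \<leadsto> Hom A (m (n y)) a"
          unfolding R_def using n_Ob by (rule INF_lower)
        also have "\<dots> \<le> T y b \<leadsto> Hom A y a"
        proof (rule residuum_mono)
          show "T y b \<le> neg (\<phi> (n y))"
            using T_le[OF y b(1)] residuum_mono[OF is_inf_lower[OF cat b(2) n_Ob] order_refl]
            by (rule order_trans)
          show "Hom A (m (n y)) a \<le> Hom A y a"
            by (rule Hom_le_pre[OF cat y m_Ob a m_n[OF y]])
        qed
        finally show ?thesis .
      qed
      then show "R \<le> Hom A b a"
        unfolding T_below[OF a b(1), symmetric] by (rule INF_greatest)
    next
      have "neg (\<phi> x) \<le> Hom A (m x) b" if x: "x \<in> Ob A" for x
      proof -
        have "neg (\<phi> x) \<le> \<phi> z \<leadsto> Hom A (m x) z" if z: "z \<in> Ob A" for z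
        proof -
          have "Hom A z x \<le> \<phi> z \<leadsto> \<phi> x"
            using \<phi> x z by (simp add: Ob_functor_cat_Omega_iff)
          also have "\<dots> \<le> neg (\<phi> x) \<leadsto> neg (\<phi> z)"
            by (metis residuum_trans residuum_adjoint mult.commute)
          finally have "neg (\<phi> x) \<le> \<phi> z \<leadsto> neg (Hom A z x)"
            by (metis le_residuum_commute residuum_left_commute)
          also have "\<dots> \<le> \<phi> z \<leadsto> Hom A (m x) z"
            by (rule residuum_mono[OF order_refl m_lower[OF z]])
          finally show ?thesis .
        qed
        then show ?thesis
          using b(2) m_Ob by (simp add: is_inf_def le_INF_iff)
      qed
      then have "Hom A b a \<le> neg (\<phi> x) \<leadsto> Hom A (m x) a" if "x \<in> Ob A" for x
        using that omega_category_trans[OF cat m_Ob b(1) a]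
        by (meson order_refl order_trans quantale_mult_mono residuum_adjoint)
      then show "Hom A b a \<le> R"
        unfolding R_def by (rule INF_greatest)
    qed
    finally show ?thesis
      by (simp add: b_def)
  qed
  ultimately show ?thesis
    by (rule completely_distributiveI[OF dual_lat])
qed

section \<open>The equivalence\<close>

theorem theorem1p1:
  assumes integral: "(1 :: 'q::comm_quantale) = top"
  shows "(girard TYPE('q) \<longleftrightarrow> cd_self_dual TYPE('q) TYPE('q)) \<and>
         (girard TYPE('q) \<longleftrightarrow> complete_heyting (dual (Omega :: ('q, 'q) omega_cat))) \<and>
         (girard TYPE('q) \<longrightarrow> cd_self_dual TYPE('a) TYPE('q))"
proof -
  have "girard TYPE('q) \<Longrightarrow> cd_self_dual TYPE('q) TYPE('q)"
    and "girard TYPE('q) \<Longrightarrow> cd_self_dual TYPE('a) TYPE('q)"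
    by (simp_all add: cd_self_dual_def girard_imp_completely_distributive_dual)
  moreover have "cd_self_dual TYPE('q) TYPE('q) \<Longrightarrow> complete_heyting (dual (Omega :: ('q, 'q) omega_cat))"
    by (simp add: cd_self_dual_def completely_distributive_Omega
        completely_distributive_imp_complete_heyting)
  moreover note complete_heyting_dual_Omega_imp_girard[OF integral]
  ultimately show ?thesis
    by blast
qed

end
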